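(* Let $n$ be a positive integer, let $R\in\mathcal{RU}_n$, and suppose $\|R\|_{\infty,\mathbb{T}}\leq 1$. Then $$ \int_{\mathbb{T}}|R'(z)|\,dm(z)\leq 6\pi\sqrt{n}. $$
   Context: $\mathbb{D}=\{z\in\mathbb{C}:|z|<1\}$ and $\mathbb{T}=\{z\in\mathbb{C}:|z|=1\}$; $m$ is the normalized Lebesgue measure on $\mathbb{T}$, $dm(z)=|dz|/(2\pi)$; $\|R\|_{\infty,\mathbb{T}}=\sup\{|R(z)|: z\in\mathbb{T}\}$. For a positive integer $n$, $\mathcal{R}_n$ is the set of all rational functions $P/Q$, where $P$ and $Q$ are polynomials in the complex variable $z$ with $\deg P\leq n$ and $\deg Q\leq n$. $\mathcal{RU}_n$ is the set of all functions in $\mathcal{R}_n$ which have no poles in the closed disk $\overline{\mathbb{D}}$ and are univalent (i.e. holomorphic and injective) in $\mathbb{D}$. *)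

theory Defs
  imports "HOL-Complex_Analysis.Complex_Analysis" "HOL-Probability.Probability"
    "HOL-Computational_Algebra.Polynomial_Factorial" "HOL-Computational_Algebra.Field_as_Ring"
begin

text \<open>A rational function is represented as a total function on \<^typ>\<open>complex\<close>. The
  representation is taken in lowest terms so that removable singularities are filled in: at a
  common zero of the two polynomials the quotient would take the junk value 0. The degree bound is
  not affected by this, see \<open>rational_functions_quotient\<close>.\<close>

definition rational_functions :: "nat \<Rightarrow> (complex \<Rightarrow> complex) set" where
  "rational_functions n =
     {R. \<exists>P Q. Q \<noteq> 0 \<and> coprime P Q \<and> degree P \<le> n \<and> degree Q \<le> n \<and>
          R = (\<lambda>z. poly P z / poly Q z)}"

lemma rational_functions_quotient:
  fixes P Q :: "complex poly"
  assumes "Q \<noteq> 0" "degree P \<le> n" "degree Q \<le> n"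
  shows "\<exists>R\<in>rational_functions n. \<forall>z. poly Q z \<noteq> 0 \<longrightarrow> R z = poly P z / poly Q z"
proof -
  define g where "g = gcd P Q"
  have g0: "g \<noteq> 0" using assms(1) by (simp add: g_def)
  obtain P' Q' where PQ: "P = P' * g" "Q = Q' * g" "coprime P' Q'"
    using gcd_coprime_exists[OF g0[unfolded g_def]] unfolding g_def by metis
  have Q'0: "Q' \<noteq> 0"
    using assms(1) unfolding PQ(2) by simp
  have "degree Q = degree Q' + degree g" unfolding PQ(2) by (rule degree_mult_eq[OF Q'0 g0])
  then have "degree Q' \<le> n" using assms(3) by linarith
  moreover have "degree P' \<le> n"
  proof (cases "P' = 0")
    case False
    then have "degree P = degree P' + degree g"
      unfolding PQ(1) using g0 by (rule degree_mult_eq)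
    then show ?thesis using assms(2) by linarith
  qed simp
  ultimately have mem: "(\<lambda>z. poly P' z / poly Q' z) \<in> rational_functions n"
    unfolding rational_functions_def mem_Collect_eq
    by (intro exI[of _ P'] exI[of _ Q'] conjI Q'0 PQ(3) refl)
  have "poly P' z / poly Q' z = poly P z / poly Q z" if "poly Q z \<noteq> 0" for z
    using that unfolding PQ(1) PQ(2) poly_mult by (simp add: divide_simps)
  then show ?thesis by (intro bexI[OF _ mem] allI impI)
qed

definition univalent_rational_functions :: "nat \<Rightarrow> (complex \<Rightarrow> complex) set" where
  "univalent_rational_functions n =
     {R \<in> rational_functions n. (\<forall>z\<in>cball 0 1. \<not> is_pole R z) \<and>
        R holomorphic_on ball 0 1 \<and> inj_on R (ball 0 1)}"

definition circle_measure :: "complex measure" where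
  "circle_measure = distr (uniform_measure lborel {0..<2 * pi}) borel cis"

definition circle_sup_norm :: "(complex \<Rightarrow> complex) \<Rightarrow> real" where
  "circle_sup_norm R = (SUP z\<in>sphere 0 1. norm (R z))"

end

theory Submission
  imports Defs
begin

text \<open>
  Let \<open>R = P/Q\<close>, and let \<open>B\<close> be the Blaschke product of degree \<open>n\<close> with \<open>R\<close> orthogonal to \<open>z B H\<^sup>2\<close>. Since
  \<open>R'\<close> is then orthogonal to \<open>B\<close> times the Bergman space, the Bergman kernel may be replaced by the square of
  \<open>k\<^sub>\<zeta>(w) = (1 - cnj(B \<zeta>) B w) / (1 - cnj \<zeta> w)\<close>: for \<open>|\<zeta>| \<le> 1\<close>,
  \<open>R'(\<zeta>) = (1/\<pi>) \<integral>\<^sub>D R' cnj(k\<^sub>\<zeta>)\<^sup>2 dA\<close>. Integrating the modulus over the circle and using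
  \<open>\<integral>\<^sub>T |k\<^sub>\<zeta>(w)|\<^sup>2 dm(\<zeta>) = u(w)\<close> with \<open>u = (1 - |B|\<^sup>2) / (1 - |w|\<^sup>2)\<close> gives
  \<open>\<integral>\<^sub>T |R'| dm \<le> (1/\<pi>) \<integral>\<^sub>D |R'| u dA\<close>. Univalence bounds the area integral of \<open>|R'|\<^sup>2\<close> by \<open>\<pi>\<close>,
  and Hardy's inequality along radii bounds that of \<open>u\<^sup>2\<close> by four times that of \<open>|B'|\<^sup>2\<close>, which is
  \<open>\<pi> n\<close>. By the Cauchy-Schwarz inequality the left-hand side is at most \<open>2 \<surd>n\<close>.
\<close>

subsection \<open>Integrals in polar coordinates\<close>

text \<open>Area integrals over the disc are taken over the closed rectangle
  \<open>polar_box\<close>, with the Jacobian factor \<open>fst p\<close> written out. Continuous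
  integrands on a compact box make integrability and the exchange of integrals immediate.\<close>

definition polar :: "real \<times> real \<Rightarrow> complex" where
  "polar p = of_real (fst p) * cis (snd p)"

abbreviation polar_box :: "(real \<times> real) set" where
  "polar_box \<equiv> cbox (0, 0) (1, 2 * pi)"

lemma polar_in_cball: "p \<in> polar_box \<Longrightarrow> polar p \<in> cball 0 1"
  by (cases p) (auto simp: polar_def norm_mult)

lemma continuous_on_polar [continuous_intros]: "continuous_on S polar"
  unfolding polar_def by (intro continuous_intros)

lemma continuous_on_compose_polar:
  assumes "continuous_on (cball 0 1) f"
  shows "continuous_on polar_box (\<lambda>p. f (polar p))"
  by (rule continuous_on_compose2[OF assms continuous_on_polar]) (use polar_in_cball in blast)

lemma continuous_on_compose_cis:
  assumes "continuous_on (cball 0 1) f"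
  shows "continuous_on S (\<lambda>t. f (cis t))"
  by (rule continuous_on_compose2[OF assms]) (auto intro!: continuous_intros)

lemma has_vector_derivative_radius:
  assumes "open U" "G holomorphic_on U" "of_real r * cis t \<in> U"
  shows "((\<lambda>r. G (of_real r * cis t)) has_vector_derivative cis t * deriv G (of_real r * cis t)) (at r)"
proof -
  have 1: "((\<lambda>r. complex_of_real r * cis t) has_vector_derivative cis t) (at r)"
    by (auto intro!: derivative_eq_intros simp: has_vector_derivative_def scaleR_conv_of_real)
  have 2: "(G has_field_derivative deriv G (of_real r * cis t)) (at (of_real r * cis t))"
    using assms holomorphic_derivI by blast
  show ?thesis using field_vector_diff_chain_at[OF 1 2] by (simp add: o_def)
qed

lemma has_vector_derivative_angle:
  assumes "open U" "G holomorphic_on U" "of_real r * cis t \<in> U"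
  shows "((\<lambda>t. G (of_real r * cis t)) has_vector_derivative
           \<i> * of_real r * cis t * deriv G (of_real r * cis t)) (at t)"
proof -
  have 1: "((\<lambda>t. of_real r * cis t) has_vector_derivative \<i> * of_real r * cis t) (at t)"
    unfolding has_vector_derivative_def
    by (auto intro!: derivative_eq_intros simp: scaleR_conv_of_real)
  have 2: "(G has_field_derivative deriv G (of_real r * cis t)) (at (of_real r * cis t))"
    using assms holomorphic_derivI by blast
  show ?thesis using field_vector_diff_chain_at[OF 1 2] by (simp add: o_def)
qed

text \<open>Green's formula in polar coordinates: in the form
  \<open>2 r cnj(G') h = \<partial>\<^sub>r (r e\<^sup>i\<^sup>\<theta> cnj(G) h) + \<i> \<partial>\<^sub>\<theta> (e\<^sup>i\<^sup>\<theta> cnj(G) h)\<close>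
  it has no singularity at \<open>r = 0\<close>.\<close>

lemma green_disc:
  assumes U: "open U" "cball 0 1 \<subseteq> U" and G: "G holomorphic_on U" and h: "h holomorphic_on U"
  shows "2 * integral polar_box (\<lambda>p. of_real (fst p) * cnj (deriv G (polar p)) * h (polar p)) =
         integral {0..2*pi} (\<lambda>t. cnj (G (cis t)) * cis t * h (cis t))"
proof -
  \<comment> \<open>\<open>A\<close> is the derivative of \<open>r * cis t * cnj G * h\<close> in
    \<open>r\<close>, and \<open>B\<close> that of \<open>cis t * cnj G * h\<close> in
    \<open>t\<close>, both expanded by the product rule.\<close>
  define A where "A = (\<lambda>p. cis (snd p) * (cnj (G (polar p)) * h (polar p)
    + of_real (fst p) * cnj (cis (snd p) * deriv G (polar p)) * h (polar p)
    + of_real (fst p) * cnj (G (polar p)) * (cis (snd p) * deriv h (polar p))))"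
  define B where "B = (\<lambda>p. \<i> * cis (snd p) * cnj (G (polar p)) * h (polar p)
    + cis (snd p) * cnj (\<i> * of_real (fst p) * cis (snd p) * deriv G (polar p)) * h (polar p)
    + cis (snd p) * cnj (G (polar p)) * (\<i> * of_real (fst p) * cis (snd p) * deriv h (polar p)))"
  have hol: "deriv G holomorphic_on U" "deriv h holomorphic_on U"
    using U G h by (auto intro: holomorphic_deriv)
  have cont: "continuous_on polar_box (\<lambda>p. f (polar p))" if "f holomorphic_on U" for f
    by (rule continuous_on_compose_polar,
        rule continuous_on_subset[OF holomorphic_on_imp_continuous_on[OF that] U(2)])
  note [continuous_intros] = cont[OF G] cont[OF h] cont[OF hol(1)] cont[OF hol(2)]
  have cA: "continuous_on polar_box A" and cB: "continuous_on polar_box B"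
    unfolding A_def B_def by (intro continuous_intros)+
  have inU: "complex_of_real r * cis t \<in> U" if "r \<in> {0..1}" for r t
    using that U by (auto intro!: subsetD[OF U(2)] simp: norm_mult)
  have "integral polar_box A = integral {0..1} (\<lambda>r. integral {0..2*pi} (\<lambda>t. A (r, t)))"
    using integral_prod_continuous[OF cA] by simp
  also have "\<dots> = integral {0..2*pi} (\<lambda>t. integral {0..1} (\<lambda>r. A (r, t)))"
    using integral_swap_continuous[of 0 0 1 "2*pi" "\<lambda>r t. A (r, t)"] cA by simp
  also have "\<dots> = integral {0..2*pi} (\<lambda>t. cnj (G (cis t)) * cis t * h (cis t))"
  proof (rule integral_cong)
    fix t :: real
    \<comment> \<open>The factor \<open>r\<close> kills the term at \<open>r = 0\<close>; the term
      at \<open>r = 1\<close> is the integrand on the circle.\<close>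
    have "((\<lambda>r. A (r, t)) has_integral
        of_real 1 * cis t * (cnj (G (of_real 1 * cis t)) * h (of_real 1 * cis t)) -
        of_real 0 * cis t * (cnj (G (of_real 0 * cis t)) * h (of_real 0 * cis t))) {0..1}"
    proof (rule fundamental_theorem_of_calculus)
      fix r :: real assume r: "r \<in> {0..1}"
      note d = has_vector_derivative_radius[OF U(1) _ inU[OF r]]
      have 0: "((\<lambda>r. complex_of_real r * cis t) has_vector_derivative cis t) (at r)"
        by (auto intro!: derivative_eq_intros simp: has_vector_derivative_def scaleR_conv_of_real)
      have "((\<lambda>r. of_real r * cis t * (cnj (G (of_real r * cis t)) * h (of_real r * cis t)))
          has_vector_derivative A (r, t)) (at r)"
        by (rule has_vector_derivative_eq_rhs[OF has_vector_derivative_mult[OF 0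
            has_vector_derivative_mult[OF bounded_linear.has_vector_derivative[OF bounded_linear_cnj d[OF G]] d[OF h]]]])
          (simp add: A_def polar_def algebra_simps)
      then show "((\<lambda>r. of_real r * cis t * (cnj (G (of_real r * cis t)) * h (of_real r * cis t)))
          has_vector_derivative A (r, t)) (at r within {0..1})"
        by (rule has_vector_derivative_at_within)
    qed simp
    then show "integral {0..1} (\<lambda>r. A (r, t)) = cnj (G (cis t)) * cis t * h (cis t)"
      by (simp add: integral_unique mult_ac)
  qed
  finally have IA: "integral polar_box A = integral {0..2*pi} (\<lambda>t. cnj (G (cis t)) * cis t * h (cis t))" .
  have "integral polar_box B = integral {0..1} (\<lambda>r. integral {0..2*pi} (\<lambda>t. B (r, t)))"
    using integral_prod_continuous[OF cB] by simp
  also have "\<dots> = integral {0..1::real} (\<lambda>r. 0)"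
  proof (rule integral_cong)
    fix r :: real assume r: "r \<in> {0..1}"
    \<comment> \<open>The boundary terms cancel because \<open>cis\<close> has period
      \<open>2 * pi\<close>.\<close>
    have "((\<lambda>t. B (r, t)) has_integral
        cis (2*pi) * (cnj (G (of_real r * cis (2*pi))) * h (of_real r * cis (2*pi))) -
        cis 0 * (cnj (G (of_real r * cis 0)) * h (of_real r * cis 0))) {0..2*pi}"
    proof (rule fundamental_theorem_of_calculus)
      fix t :: real
      note d = has_vector_derivative_angle[OF U(1) _ inU[OF r]]
      have 0: "(cis has_vector_derivative \<i> * cis t) (at t)"
        by (auto intro!: derivative_eq_intros simp: has_vector_derivative_def scaleR_conv_of_real)
      have "((\<lambda>t. cis t * (cnj (G (of_real r * cis t)) * h (of_real r * cis t)))
          has_vector_derivative B (r, t)) (at t)"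
        by (rule has_vector_derivative_eq_rhs[OF has_vector_derivative_mult[OF 0
            has_vector_derivative_mult[OF bounded_linear.has_vector_derivative[OF bounded_linear_cnj d[OF G]] d[OF h]]]])
          (simp add: B_def polar_def algebra_simps)
      then show "((\<lambda>t. cis t * (cnj (G (of_real r * cis t)) * h (of_real r * cis t)))
          has_vector_derivative B (r, t)) (at t within {0..2*pi})"
        by (rule has_vector_derivative_at_within)
    qed simp
    then show "integral {0..2*pi} (\<lambda>t. B (r, t)) = 0"
      by (simp add: integral_unique)
  qed
  finally have IB: "integral polar_box B = 0" by simp
  \<comment> \<open>In \<open>A + \<i> * B\<close> the terms without \<open>deriv G\<close> cancel
    and the two with it coincide.\<close>
  have AB: "2 * (of_real (fst p) * cnj (deriv G (polar p)) * h (polar p)) = A p + \<i> * B p" for p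
  proof -
    have c: "cis (snd p) * cnj (cis (snd p)) = 1" by (simp add: cis_cnj cis_mult)
    have "A p + \<i> * B p = 2 * (of_real (fst p) * cnj (deriv G (polar p)) * h (polar p)) * (cis (snd p) * cnj (cis (snd p)))"
      by (simp add: A_def B_def algebra_simps)
    then show ?thesis using c by simp
  qed
  have "2 * integral polar_box (\<lambda>p. of_real (fst p) * cnj (deriv G (polar p)) * h (polar p)) =
     integral polar_box (\<lambda>p. A p + \<i> * B p)"
    by (simp only: AB[symmetric] integral_mult_right)
  also have "\<dots> = integral polar_box A + \<i> * integral polar_box B"
    using cA cB by (subst integral_add) (auto intro!: integrable_continuous continuous_intros)
  finally show ?thesis using IA IB by simp
qed

section \<open>Cauchy's formulas as integrals over the angle\<close>

lemma integral_cis_eq_contour_integral: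
  "integral {0..2*pi} (\<lambda>t. cis t * f (cis t)) = contour_integral (circlepath 0 1) f / \<i>"
proof -
  have "contour_integral (circlepath 0 1) f = integral {0..2*pi} (\<lambda>t. \<i> * (cis t * f (cis t)))"
    unfolding circlepath_def
    by (subst contour_integral_part_circlepath_eq) (simp_all add: mult_ac)
  then show ?thesis by simp
qed

lemma integral_cis_Cauchy:
  fixes f :: "complex \<Rightarrow> complex"
  assumes "continuous_on (cball 0 1) f" "f holomorphic_on ball 0 1" "norm w < 1"
  shows "integral {0..2*pi} (\<lambda>t. cis t * (f (cis t) / (cis t - w))) = 2 * pi * f w"
  using contour_integral_unique[OF Cauchy_integral_circlepath[OF assms(1,2), of w]] assms(3)
  unfolding integral_cis_eq_contour_integral[of "\<lambda>z. f z / (z - w)"] by simp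

lemma integral_cis_Cauchy_deriv:
  fixes f :: "complex \<Rightarrow> complex"
  assumes "continuous_on (cball 0 1) f" "f holomorphic_on ball 0 1" "norm w < 1"
  shows "integral {0..2*pi} (\<lambda>t. cis t * (f (cis t) / (cis t - w)\<^sup>2)) = 2 * pi * deriv f w"
  using DERIV_imp_deriv[OF Cauchy_derivative_integral_circlepath(2)[OF assms(1,2), of w]] assms(3)
  unfolding integral_cis_eq_contour_integral[of "\<lambda>z. f z / (z - w)\<^sup>2"] by simp

text \<open>Cauchy's formula at 0 for \<open>z * f z\<close>, which vanishes there.\<close>

lemma integral_cis_holomorphic:
  fixes f :: "complex \<Rightarrow> complex"
  assumes "continuous_on (cball 0 1) f" "f holomorphic_on ball 0 1"
  shows "integral {0..2*pi} (\<lambda>t. cis t * f (cis t)) = 0"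
  using integral_cis_Cauchy[of "\<lambda>z. z * f z" 0] assms
  by (simp add: continuous_on_mult holomorphic_on_mult continuous_on_id holomorphic_on_ident)

text \<open>By density of the open disc. Kernel identities are first proved at interior points,
  where \<open>1 - cnj z * w\<close> does not vanish, and are carried to the circle by this.\<close>

lemma eq_on_cball:
  fixes f g :: "complex \<Rightarrow> 'a::real_normed_vector"
  assumes "continuous_on (cball 0 1) f" "continuous_on (cball 0 1) g"
    and "\<And>z. norm z < 1 \<Longrightarrow> f z = g z" and "norm z \<le> 1"
  shows "f z = g z"
proof -
  have "f z - g z = 0"
    by (rule continuous_constant_on_closure[of "ball 0 1"])
      (use assms in \<open>auto intro!: continuous_intros\<close>)
  then show ?thesis by simp
qed

subsection \<open>The area of a univalent image\<close>

text \<open>Iterated integrals live on \<open>real \<times> real\<close>, while the determinant in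
  the change of variables lives on \<open>real^2\<close>. The coordinate map preserves boxes and
  their content.\<close>

lemma has_integral_real2_pair:
  fixes F :: "real \<times> real \<Rightarrow> real"
  assumes "(F has_integral i) (cbox (a, c) (b, d))"
  shows "((\<lambda>x::real^2. F (x $ 1, x $ 2)) has_integral i) (cbox (vector [a, c]) (vector [b, d]))"
proof -
  let ?g = "\<lambda>x::real^2. (x $ 1, x $ 2)" and ?h = "\<lambda>p::real\<times>real. (vector [fst p, snd p] :: real^2)"
  have hg: "?h (?g x) = x" for x by (simp add: vec_eq_iff forall_2)
  have gh: "?g (?h p) = p" for p by simp
  have g: "?g ` cbox u v = cbox (u $ 1, u $ 2) (v $ 1, v $ 2)" for u v
  proof (intro equalityI subsetI)
    fix p assume "p \<in> cbox (u $ 1, u $ 2) (v $ 1, v $ 2)"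
    then have "?h p \<in> cbox u v" by (cases p) (auto simp: mem_box_cart forall_2)
    then show "p \<in> ?g ` cbox u v" by (rule image_eqI[rotated]) simp
  qed (auto simp: mem_box_cart)
  have h: "?h ` cbox u v = cbox (?h u) (?h v)" for u v
  proof -
    have "cbox u v = ?g ` cbox (?h u) (?h v)" by (simp add: g)
    then show ?thesis by (simp add: image_image hg[simplified])
  qed
  have "((\<lambda>x. F (?g x)) has_integral (1 / 1) *\<^sub>R i) (?h ` cbox (a, c) (b, d))"
  proof (rule has_integral_twiddle[where g = ?g, OF _ hg gh _ _ _ _ assms])
    show "continuous (at x) ?g" for x by (intro continuous_intros)
    show "\<exists>w z. ?g ` cbox u v = cbox w z" for u v using g by blast
    show "\<exists>w z. ?h ` cbox u v = cbox w z" for u v using h by blast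
    show "measure lborel (?g ` cbox u v) = 1 * measure lborel (cbox u v)" for u v :: "real^2"
    proof -
      \<comment> \<open>Empty boxes have content 0 and are split off before the product formulas are
        compared.\<close>
      have "(\<exists>i::2. v $ i < u $ i) \<longleftrightarrow> v $ 1 < u $ 1 \<or> v $ 2 < u $ 2"
        using forall_2[of "\<lambda>i. \<not> v $ i < u $ i"] by blast
      then show ?thesis
        by (auto simp: g content_Pair content_cbox_if_cart interval_eq_empty_cart UNIV_2 content_real_if)
    qed
  qed simp
  then show ?thesis by (simp add: h)
qed

text \<open>The open rectangle leaves out the origin and the positive real axis, where the angle is
  ambiguous; elsewhere \<open>Arg2pi\<close> recovers it.\<close>

lemma polar_inj_on: "inj_on polar ({0<..<1} \<times> {0<..<2 * pi})"
proof (rule inj_onI)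
  fix p q assume p: "p \<in> {0<..<1} \<times> {0<..<2 * pi}" and q: "q \<in> {0<..<1} \<times> {0<..<2 * pi}"
    and eq: "polar p = polar q"
  have b: "0 < fst p" "0 < snd p" "snd p < 2 * pi" "0 < fst q" "0 < snd q" "snd q < 2 * pi"
    using p q by auto
  have "norm (polar p) = norm (polar q)" using eq by simp
  then have 1: "fst p = fst q" using b by (simp add: polar_def norm_mult)
  have "Arg2pi (polar p) = snd p" "Arg2pi (polar q) = snd q"
    using b by (auto intro!: Arg2pi_unique simp: polar_def cis_conv_exp)
  then have "snd p = snd q" using eq by simp
  with 1 show "p = q" by (simp add: prod_eq_iff)
qed

text \<open>In polar coordinates \<open>R\<close> has Jacobian \<open>r * |R'|^2\<close>. Univalence
  makes the map injective on the open rectangle, so the integral is the area of the image, which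
  lies in the unit disc.\<close>

lemma univalent_area_le:
  assumes U: "open U" "cball 0 1 \<subseteq> U" and R: "R holomorphic_on U"
    and inj: "inj_on R (ball 0 1)" and bound: "\<And>z. norm z < 1 \<Longrightarrow> norm (R z) \<le> 1"
  shows "integral polar_box (\<lambda>p. fst p * (norm (deriv R (polar p)))\<^sup>2) \<le> pi"
proof -
  define F where "F = (\<lambda>p. fst p * (norm (deriv R (polar p)))\<^sup>2)"
  define a where "a = (vector [0, 0] :: real^2)"
  define b where "b = (vector [1, 2 * pi] :: real^2)"
  define g where "g = (\<lambda>x::real^2. (x $ 1, x $ 2))"
  define T where "T = (\<lambda>z::complex. (vector [Re z, Im z] :: real^2))"
  have T: "linear T"
    by (rule linearI) (auto simp: T_def vec_eq_iff forall_2)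
  have "deriv R holomorphic_on U" using R U(1) by (rule holomorphic_deriv)
  then have "continuous_on (cball 0 1) (deriv R)"
    using U(2) by (meson continuous_on_subset holomorphic_on_imp_continuous_on)
  then have cF: "continuous_on polar_box F"
    unfolding F_def by (intro continuous_intros continuous_on_compose_polar)
  have F: "((\<lambda>x. F (g x)) has_integral integral polar_box F) (cbox a b)"
    unfolding g_def a_def b_def
    by (rule has_integral_real2_pair) (use cF in \<open>auto intro!: integrable_integral integrable_continuous\<close>)
  \<comment> \<open>The boundary of the box is negligible, and injectivity holds only on the open
    box.\<close>
  then have F': "((\<lambda>x. F (g x)) has_integral integral polar_box F) (box a b)"
    by (simp add: has_integral_open_interval)
  have box: "g x \<in> {0<..<1} \<times> {0<..<2 * pi}" if "x \<in> box a b" for x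
    using that by (auto simp: g_def a_def b_def mem_box_cart forall_2)
  have inball: "polar (g x) \<in> ball 0 1" if "x \<in> box a b" for x
    using box[OF that] by (auto simp: polar_def norm_mult)
  define f where "f = (\<lambda>x. T (R (polar (g x))))"
  define f' where "f' = (\<lambda>(x::real^2) (h::real^2). T (deriv R (polar (g x)) * (of_real (h $ 1) * cis (x $ 2) + of_real (h $ 2) * (\<i> * of_real (x $ 1) * cis (x $ 2)))))"
  have der: "(f has_derivative f' x) (at x within box a b)" if x: "x \<in> box a b" for x
  proof -
    have 1: "((\<lambda>x. polar (g x)) has_derivative (\<lambda>h::real^2. of_real (h $ 1) * cis (x $ 2) + of_real (h $ 2) * (\<i> * of_real (x $ 1) * cis (x $ 2)))) (at x)"
      unfolding polar_def g_def fst_conv snd_conv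
      by (auto intro!: derivative_eq_intros bounded_linear_imp_has_derivative bounded_linear_vec_nth
          simp: scaleR_conv_of_real algebra_simps)
    have "(R has_field_derivative deriv R (polar (g x))) (at (polar (g x)))"
      using inball[OF x] U R by (intro holomorphic_derivI[of _ U]) auto
    then have 2: "(R has_derivative (*) (deriv R (polar (g x)))) (at (polar (g x)))"
      by (simp add: has_field_derivative_def)
    have "(f has_derivative f' x) (at x)"
      unfolding f_def f'_def
      using bounded_linear.has_derivative[OF linear_conv_bounded_linear[THEN iffD1, OF T] has_derivative_compose[OF 1 2]]
      by simp
    then show ?thesis by (rule has_derivative_at_withinI)
  qed
  have det: "\<bar>det (matrix (f' x))\<bar> = F (g x)" if x: "x \<in> box a b" for x
  proof -
    \<comment> \<open>The partial derivatives in \<open>r\<close> and \<open>t\<close> are the plane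
      vectors \<open>c\<close> and \<open>\<i> * r * c\<close>. They are orthogonal, so the
      determinant is \<open>r * |c|^2\<close>.\<close>
    define c where "c = deriv R (polar (g x)) * cis (x $ 2)"
    have r: "0 \<le> x $ 1" using box[OF x] by (auto simp: g_def)
    have e: "f' x (axis 1 1) = T c" "f' x (axis 2 1) = T (\<i> * of_real (x $ 1) * c)"
      by (simp_all add: f'_def c_def axis_def mult_ac)
    have "det (matrix (f' x)) = x $ 1 * ((Re c)\<^sup>2 + (Im c)\<^sup>2)"
      by (simp add: det_2 matrix_def e T_def power2_eq_square algebra_simps)
    also have "(Re c)\<^sup>2 + (Im c)\<^sup>2 = (norm (deriv R (polar (g x))))\<^sup>2"
      unfolding cmod_power2[symmetric] by (simp add: c_def norm_mult)
    finally show ?thesis using r by (simp add: F_def g_def)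
  qed
  have injf: "inj_on f (box a b)"
  proof (rule inj_onI)
    fix x y assume x: "x \<in> box a b" and y: "y \<in> box a b" and eq: "f x = f y"
    have "R (polar (g x)) = R (polar (g y))"
      using eq by (auto simp: f_def T_def vec_eq_iff forall_2 complex_eq_iff)
    then have "polar (g x) = polar (g y)" using inj inball x y by (auto dest: inj_onD)
    then have "g x = g y" using polar_inj_on box x y by (auto dest: inj_onD)
    then show "x = y" by (simp add: g_def vec_eq_iff forall_2)
  qed
  have "((\<lambda>x. \<bar>det (matrix (f' x))\<bar>) has_integral integral polar_box F) (box a b)"
    using F' by (rule has_integral_eq[rotated]) (simp add: det)
  then have m: "f ` box a b \<in> lmeasurable" "measure lebesgue (f ` box a b) = integral polar_box F"
    using has_measure_differentiable_image[OF _ der injf] by auto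
  have "measure lebesgue (f ` box a b) \<le> measure lebesgue (cball (0::real^2) 1)"
  proof (rule measure_mono_fmeasurable)
    show "f ` box a b \<subseteq> cball 0 1"
    proof safe
      fix x assume "x \<in> box a b"
      then have "norm (R (polar (g x))) \<le> 1" using bound inball by auto
      then show "f x \<in> cball 0 1"
        by (simp add: f_def T_def norm_vec_def L2_set_def sum_2 cmod_def)
    qed
  qed (use m in auto)
  also have "\<dots> = pi" by (simp add: content_cball unit_ball_vol_2)
  finally show ?thesis using m by (simp add: F_def)
qed

subsection \<open>Blaschke product and reproducing kernel\<close>

text \<open>For \<open>degree p \<le> n\<close> and nonzero \<open>z\<close> this is the reciprocal
  polynomial \<open>z ^ n * cnj (poly p (1 / cnj z))\<close>, taken with respect to \<open>n\<close>
  rather than \<open>degree p\<close>.\<close>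

definition conj_rev :: "nat \<Rightarrow> complex poly \<Rightarrow> complex \<Rightarrow> complex" where
  "conj_rev n p z = (\<Sum>k\<le>n. cnj (coeff p k) * z ^ (n - k))"

lemma holomorphic_on_conj_rev [holomorphic_intros]: "conj_rev n p holomorphic_on S"
  unfolding conj_rev_def[abs_def] by (intro holomorphic_intros)

lemma continuous_on_conj_rev: "continuous_on S (conj_rev n p)"
  by (intro holomorphic_on_imp_continuous_on holomorphic_intros)

lemma poly_eq_sum:
  fixes p :: "'a::comm_semiring_1 poly"
  assumes "degree p \<le> n"
  shows "poly p x = (\<Sum>k\<le>n. coeff p k * x ^ k)"
  unfolding poly_altdef
  by (rule sum.mono_neutral_left) (use assms in \<open>auto simp: coeff_eq_0\<close>)

text \<open>On the circle \<open>cnj z\<close> is inverse to \<open>z\<close>. This turns conjugates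
  of \<open>P\<close> and \<open>Q\<close> into holomorphic functions there.\<close>

lemma conj_rev_circle:
  assumes "degree p \<le> n" "norm z = 1"
  shows "conj_rev n p z = z ^ n * cnj (poly p z)"
proof -
  have z: "z * cnj z = 1" using complex_norm_square[of z] assms(2) by simp
  have "z ^ (n - k) = z ^ n * cnj z ^ k" if "k \<le> n" for k
  proof -
    have "z ^ n = z ^ (n - k) * z ^ k" using that by (simp flip: power_add)
    then have "z ^ n * cnj z ^ k = z ^ (n - k) * (z * cnj z) ^ k" by (simp add: power_mult_distrib)
    then show ?thesis by (simp add: z)
  qed
  then show ?thesis
    unfolding conj_rev_def poly_eq_sum[OF assms(1)]
    by (simp add: sum_distrib_left mult_ac)
qed

text \<open>The polynomial quotient of \<open>w ^ j * x ^ i - w ^ (n - i) * x ^ (n - j)\<close> by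
  \<open>1 - x * w\<close>: the monomial dividing the other is taken out and a finite geometric sum
  remains, which is empty for \<open>i + j = n\<close>.\<close>

definition geometric_cofactor :: "nat \<Rightarrow> nat \<Rightarrow> nat \<Rightarrow> 'a::comm_ring_1 \<Rightarrow> 'a \<Rightarrow> 'a" where
  "geometric_cofactor n i j x w =
    (if i + j \<le> n then w ^ j * x ^ i * (\<Sum>l<n - i - j. (x * w) ^ l)
     else - (w ^ (n - i) * x ^ (n - j) * (\<Sum>l<i + j - n. (x * w) ^ l)))"

lemma continuous_on_geometric_cofactor [continuous_intros]:
  fixes f g :: "'a::topological_space \<Rightarrow> complex"
  assumes "continuous_on S f" "continuous_on S g"
  shows "continuous_on S (\<lambda>p. geometric_cofactor n i j (f p) (g p))"
  using assms unfolding geometric_cofactor_def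
  by (cases "i + j \<le> n") (auto intro!: continuous_intros)

lemma holomorphic_on_geometric_cofactor [holomorphic_intros]:
  "geometric_cofactor n i j x holomorphic_on S"
  unfolding geometric_cofactor_def[abs_def]
  by (cases "i + j \<le> n") (auto intro!: holomorphic_intros)

lemma geometric_factor:
  fixes x w :: "'a::comm_ring_1"
  assumes "i \<le> n" "j \<le> n"
  shows "w ^ j * x ^ i - w ^ (n - i) * x ^ (n - j) = (1 - x * w) * geometric_cofactor n i j x w"
proof -
  have g: "(1 - y) * (\<Sum>l<m. y ^ l) = 1 - y ^ m" for y :: 'a and m
    by (simp add: one_diff_power_eq)
  show ?thesis
  proof (cases "i + j \<le> n")
    case True
    then have "n - i = j + (n - i - j)" "n - j = i + (n - i - j)" by auto
    then have "w ^ (n - i) = w ^ j * w ^ (n - i - j)" "x ^ (n - j) = x ^ i * x ^ (n - i - j)"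
      by (metis power_add)+
    then have "w ^ j * x ^ i - w ^ (n - i) * x ^ (n - j) = w ^ j * x ^ i * (1 - (x * w) ^ (n - i - j))"
      by (simp add: algebra_simps power_mult_distrib)
    then show ?thesis using True by (simp add: geometric_cofactor_def) (simp add: g[symmetric] mult_ac)
  next
    case False
    then have "j = (n - i) + (i + j - n)" "i = (n - j) + (i + j - n)" using assms by auto
    then have "w ^ j = w ^ (n - i) * w ^ (i + j - n)" "x ^ i = x ^ (n - j) * x ^ (i + j - n)"
      by (metis power_add)+
    then have "w ^ j * x ^ i - w ^ (n - i) * x ^ (n - j) = - (w ^ (n - i) * x ^ (n - j) * (1 - (x * w) ^ (i + j - n)))"
      by (simp add: algebra_simps power_mult_distrib)
    then show ?thesis using False by (simp add: geometric_cofactor_def) (simp add: g[symmetric] mult_ac)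
  qed
qed

text \<open>The function \<open>B\<close> below is, up to a constant factor, the Blaschke product of degree \<open>n\<close> whose zeros are the
  reflections in the unit circle of the zeros of \<open>Q\<close>, completed by zeros at the origin.\<close>

locale zero_free_disc =
  fixes Q :: "complex poly" and n :: nat
  assumes degree_le: "degree Q \<le> n"
    and nonzero: "norm z \<le> 1 \<Longrightarrow> poly Q z \<noteq> 0"
begin

definition U :: "complex set" where "U = {z. poly Q z \<noteq> 0}"

lemma open_U: "open U"
proof -
  have "U = poly Q -` (- {0})" by (auto simp: U_def)
  then show ?thesis by (auto intro!: open_vimage continuous_intros)
qed

lemma cball_subset_U: "cball 0 1 \<subseteq> U" and ball_subset_U: "ball 0 1 \<subseteq> U"
  using nonzero by (auto simp: U_def)

lemma mem_U: "norm z \<le> 1 \<Longrightarrow> z \<in> U"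
  using nonzero by (auto simp: U_def)

lemma continuous_on_cballI: "f holomorphic_on U \<Longrightarrow> continuous_on (cball 0 1) f"
  by (meson cball_subset_U continuous_on_subset holomorphic_on_imp_continuous_on)

lemma holomorphic_on_ballI: "f holomorphic_on U \<Longrightarrow> f holomorphic_on ball 0 1"
  by (meson ball_subset_U holomorphic_on_subset)

definition B :: "complex \<Rightarrow> complex" where
  "B z = conj_rev n Q z / poly Q z"

lemma holomorphic_B: "B holomorphic_on U"
  unfolding B_def[abs_def] by (intro holomorphic_intros) (auto simp: U_def)

lemma norm_B_circle: "norm z = 1 \<Longrightarrow> norm (B z) = 1"
  by (simp add: B_def conj_rev_circle[OF degree_le] norm_divide norm_mult norm_power nonzero)

lemma norm_B_le: "norm z \<le> 1 \<Longrightarrow> norm (B z) \<le> 1"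
  by (rule maximum_modulus_frontier[of B "cball 0 1"])
    (use holomorphic_on_ballI[OF holomorphic_B] continuous_on_cballI[OF holomorphic_B] norm_B_circle in auto)

section \<open>The kernel and its reproducing property\<close>

text \<open>Numerator of the kernel, a polynomial in \<open>w\<close> and in \<open>x\<close>, which
  stands for \<open>cnj z\<close>.\<close>

definition E :: "complex \<Rightarrow> complex \<Rightarrow> complex" where
  "E x w = (\<Sum>i\<le>n. \<Sum>j\<le>n. cnj (coeff Q i) * coeff Q j * geometric_cofactor n i j x w)"

text \<open>This is \<open>(1 - cnj(B z) B w) / (1 - cnj z w)\<close>, written with the denominator cancelled so that it is defined and
  continuous on the closed bidisc.\<close>

definition kern :: "complex \<Rightarrow> complex \<Rightarrow> complex" where
  "kern z w = E (cnj z) w / (cnj (poly Q z) * poly Q w)"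

text \<open>Both products are expanded over pairs of coefficients. Exchanging the sums in the second
  one pairs each \<open>w ^ j * cnj z ^ i\<close> with \<open>w ^ (n - i) * cnj z ^ (n - j)\<close>,
  and \<open>geometric_factor\<close> divides their difference.\<close>

lemma E_eq: "cnj (poly Q z) * poly Q w - cnj (conj_rev n Q z) * conj_rev n Q w = (1 - cnj z * w) * E (cnj z) w"
proof -
  have "cnj (poly Q z) * poly Q w - cnj (conj_rev n Q z) * conj_rev n Q w =
     (\<Sum>i\<le>n. \<Sum>j\<le>n. (cnj (coeff Q i) * cnj z ^ i) * (coeff Q j * w ^ j)) -
     (\<Sum>j\<le>n. \<Sum>i\<le>n. (coeff Q j * cnj z ^ (n - j)) * (cnj (coeff Q i) * w ^ (n - i)))"
    by (simp add: poly_eq_sum[OF degree_le] conj_rev_def sum_product)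
  also have "\<dots> = (\<Sum>i\<le>n. \<Sum>j\<le>n. cnj (coeff Q i) * coeff Q j * (w ^ j * cnj z ^ i - w ^ (n - i) * cnj z ^ (n - j)))"
    by (subst (2) sum.swap) (simp add: sum_subtractf[symmetric] algebra_simps)
  also have "\<dots> = (1 - cnj z * w) * E (cnj z) w"
    unfolding E_def sum_distrib_left
    by (intro sum.cong refl) (simp add: geometric_factor mult_ac)
  finally show ?thesis .
qed

lemma kern_eq:
  assumes "norm z \<le> 1" "norm w \<le> 1"
  shows "(1 - cnj z * w) * kern z w = 1 - cnj (B z) * B w"
proof -
  have "cnj (poly Q z) \<noteq> 0" "poly Q w \<noteq> 0" using nonzero assms by auto
  then show ?thesis
    using E_eq[of z w] by (simp add: kern_def B_def field_simps)
qed

lemma continuous_on_kern: "continuous_on (cball 0 1 \<times> cball 0 1) (\<lambda>(z, w). kern z w)"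
proof -
  have "continuous_on UNIV (\<lambda>p. E (cnj (fst p)) (snd p))"
    unfolding E_def by (intro continuous_intros)
  then have "continuous_on S (\<lambda>p. E (cnj (fst p)) (snd p))" for S
    using continuous_on_subset by blast
  then show ?thesis
    unfolding kern_def split_beta
    by (intro continuous_intros) (auto simp: nonzero)
qed

lemma holomorphic_kern: "kern z holomorphic_on U"
proof -
  have E: "E x holomorphic_on S" for x S
    unfolding E_def[abs_def] by (intro holomorphic_intros)
  show ?thesis
  \<comment> \<open>If \<open>poly Q z = 0\<close>, division by zero makes \<open>kern z\<close> the
    zero function.\<close>
  proof (cases "poly Q z = 0")
    case False
    then show ?thesis
      unfolding kern_def[abs_def] by (intro holomorphic_intros E) (auto simp: U_def)
  qed (simp add: kern_def[abs_def])
qed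

lemma denom_nonzero:
  assumes "norm z < 1" "norm w \<le> 1"
  shows "1 - cnj z * w \<noteq> 0"
proof
  assume "1 - cnj z * w = 0"
  then have "norm (cnj z * w) = 1" by (metis eq_iff_diff_eq_0 norm_one)
  moreover have "norm (cnj z * w) \<le> norm z" using assms by (simp add: norm_mult mult_left_le)
  ultimately show False using assms by simp
qed

text \<open>Expanding the square of the kernel leaves the Bergman kernel plus a multiple of \<open>B\<close>. The latter contributes
  nothing because \<open>cnj R * B\<close> has a holomorphic extension from the circle to the disc.\<close>

lemma reproducing_aux:
  assumes P: "degree P \<le> n" and R: "\<And>w. R w = poly P w / poly Q w" and z: "norm z < 1"
  shows "integral polar_box (\<lambda>p. of_real (fst p) * cnj (deriv R (polar p)) * (kern z (polar p))\<^sup>2) =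
     pi * cnj (deriv R z)"
proof -
  have R': "R = (\<lambda>w. poly P w / poly Q w)" using R by auto
  have holR: "R holomorphic_on U"
    unfolding R' by (intro holomorphic_intros) (auto simp: U_def)
  define c where "c = cnj (B z)"
  \<comment> \<open>\<open>f\<close> collects the terms of \<open>cnj R\<close> times the squared
    kernel that contain \<open>B\<close>, with \<open>cnj R * B\<close> replaced by its holomorphic
    extension.\<close>
  define f where "f = (\<lambda>w. conj_rev n P w / poly Q w * (c\<^sup>2 * B w - 2 * c) / (1 - cnj z * w)\<^sup>2)"
  have f_cont: "continuous_on (cball 0 1) f"
    unfolding f_def using nonzero denom_nonzero[OF z]
    by (intro continuous_intros continuous_on_conj_rev continuous_on_cballI[OF holomorphic_B]) auto
  have f_hol: "f holomorphic_on ball 0 1"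
    unfolding f_def using nonzero denom_nonzero[OF z]
    by (intro holomorphic_intros holomorphic_on_ballI[OF holomorphic_B]) auto
  have *: "cnj (R (cis t)) * cis t * (kern z (cis t))\<^sup>2 =
      cnj (cis t * (R (cis t) / (cis t - z)\<^sup>2)) + cis t * f (cis t)" for t
  proof -
    define e where "e = cis t"
    have e: "norm e = 1" "e \<noteq> 0" "cnj e = inverse e" by (auto simp: e_def cis_cnj)
    have d: "1 - cnj z * e \<noteq> 0" using denom_nonzero[OF z, of e] e by simp
    have k: "kern z e = (1 - c * B e) / (1 - cnj z * e)"
      using kern_eq[of z e] z e d by (simp add: c_def field_simps)
    have q: "poly Q e \<noteq> 0" "cnj (poly Q e) \<noteq> 0" using nonzero e by auto
    \<comment> \<open>The factor \<open>cnj (poly Q e)\<close> of \<open>B e\<close> cancels the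
      denominator of \<open>cnj (R e)\<close>, and \<open>e ^ n * cnj (poly P e)\<close> is
      \<open>conj_rev n P e\<close>.\<close>
    have RB: "cnj (R e) * B e = conj_rev n P e / poly Q e"
      using q e by (simp add: R B_def conj_rev_circle[OF P] conj_rev_circle[OF degree_le] field_simps)
    \<comment> \<open>The Bergman part is the conjugate of the Cauchy integrand for
      \<open>deriv R z\<close>.\<close>
    have 1: "cnj (e * (R e / (e - z)\<^sup>2)) = cnj (R e) * e / (1 - cnj z * e)\<^sup>2"
    proof -
      have "cnj e - cnj z = (1 - cnj z * e) / e" using e by (simp add: field_simps)
      then show ?thesis
        by (simp only: complex_cnj_mult complex_cnj_divide complex_cnj_power complex_cnj_diff e(3))
          (use e in \<open>simp add: power_divide power2_eq_square\<close>)
    qed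
    have 2: "e * f e = cnj (R e) * e * ((c * B e)\<^sup>2 - 2 * (c * B e)) / (1 - cnj z * e)\<^sup>2"
      unfolding f_def RB[symmetric] by (simp add: algebra_simps power2_eq_square)
    show ?thesis
      unfolding e_def[symmetric] 1 2 k
      using d by (simp add: power_divide add_divide_distrib[symmetric] power2_eq_square algebra_simps)
  qed
  have c1: "continuous_on {0..2*pi} (\<lambda>t. cnj (cis t * (R (cis t) / (cis t - z)\<^sup>2)))"
    using z by (intro continuous_intros continuous_on_compose_cis[OF continuous_on_cballI[OF holR]]) auto
  have c2: "continuous_on {0..2*pi} (\<lambda>t. cis t * f (cis t))"
    by (intro continuous_intros continuous_on_compose_cis[OF f_cont])
  have "2 * integral polar_box (\<lambda>p. of_real (fst p) * cnj (deriv R (polar p)) * (kern z (polar p))\<^sup>2) =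
      integral {0..2*pi} (\<lambda>t. cnj (R (cis t)) * cis t * (kern z (cis t))\<^sup>2)"
    by (rule green_disc[OF open_U cball_subset_U holR]) (intro holomorphic_intros holomorphic_kern)
  also have "\<dots> = integral {0..2*pi} (\<lambda>t. cnj (cis t * (R (cis t) / (cis t - z)\<^sup>2)) + cis t * f (cis t))"
    by (simp only: *)
  also have "\<dots> = integral {0..2*pi} (\<lambda>t. cnj (cis t * (R (cis t) / (cis t - z)\<^sup>2))) +
      integral {0..2*pi} (\<lambda>t. cis t * f (cis t))"
    using c1 c2 by (intro integral_add integrable_continuous_real)
  also have "\<dots> = 2 * pi * cnj (deriv R z)"
    using integral_cis_Cauchy_deriv[OF continuous_on_cballI[OF holR] holomorphic_on_ballI[OF holR] z]
      integral_cis_holomorphic[OF f_cont f_hol]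
    by (simp only: integral_cnj[symmetric]) simp
  finally show ?thesis by simp
qed

text \<open>The formula is wanted on the circle, where the Bergman kernel is singular; the cancelled
  form of \<open>kern\<close> keeps both sides continuous up to there.\<close>

lemma reproducing:
  assumes P: "degree P \<le> n" and R: "\<And>w. R w = poly P w / poly Q w" and z: "norm z \<le> 1"
  shows "integral polar_box (\<lambda>p. of_real (fst p) * cnj (deriv R (polar p)) * (kern z (polar p))\<^sup>2) =
     pi * cnj (deriv R z)"
proof -
  have R': "R = (\<lambda>w. poly P w / poly Q w)" using R by auto
  have "R holomorphic_on U"
    unfolding R' by (intro holomorphic_intros) (auto simp: U_def)
  then have "deriv R holomorphic_on U" by (rule holomorphic_deriv[OF _ open_U])
  note cR = continuous_on_cballI[OF this]
  show ?thesis
  proof (rule eq_on_cball[OF _ _ reproducing_aux[OF P R] z])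
    show "continuous_on (cball 0 1) (\<lambda>z. pi * cnj (deriv R z))"
      by (intro continuous_intros cR)
    show "continuous_on (cball 0 1) (\<lambda>z. integral polar_box
        (\<lambda>p. of_real (fst p) * cnj (deriv R (polar p)) * (kern z (polar p))\<^sup>2))"
    proof (rule integral_continuous_on_param)
      have 1: "continuous_on (cball 0 1 \<times> polar_box) (\<lambda>q. kern (fst q) (polar (snd q)))"
        by (rule continuous_on_compose2[OF continuous_on_kern, of _ "\<lambda>q. (fst q, polar (snd q))", unfolded split_beta fst_conv snd_conv])
          (use polar_in_cball in \<open>force intro!: continuous_intros continuous_on_compose2[OF continuous_on_polar[of UNIV]]\<close>)+
      have 2: "continuous_on (cball 0 1 \<times> polar_box) (\<lambda>q. deriv R (polar (snd q)))"
        by (rule continuous_on_compose2[OF continuous_on_compose_polar[OF cR] continuous_on_snd[OF continuous_on_id]]) auto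
      show "continuous_on (cball 0 1 \<times> polar_box)
         (\<lambda>(z, p). complex_of_real (fst p) * cnj (deriv R (polar p)) * (kern z (polar p))\<^sup>2)"
        unfolding split_beta by (intro continuous_intros 1 2)
    qed
  qed
qed

section \<open>Integrals of the kernel and of the derivative of \<open>B\<close>\<close>

text \<open>For \<open>|e| = 1\<close> also \<open>|B e| = 1\<close>, so the numerator of
  \<open>|kern e w|^2\<close> is the real part of a function holomorphic in \<open>e\<close>, while
  the denominator is \<open>(e - w) * (1 - cnj w * e) / e\<close>. The integrand is thus the real
  part of the Cauchy integrand of \<open>f\<close> at \<open>w\<close>.\<close>

lemma integral_norm_kern_aux:
  assumes w: "norm w < 1"
  shows "integral {0..2*pi} (\<lambda>t. (norm (kern (cis t) w))\<^sup>2) = 2 * pi * Re (kern w w)"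
proof -
  define f where "f = (\<lambda>z. (1 + B w * cnj (B w) - 2 * cnj (B w) * B z) / (1 - cnj w * z))"
  have f_cont: "continuous_on (cball 0 1) f"
    unfolding f_def using denom_nonzero[OF w]
    by (intro continuous_intros continuous_on_cballI[OF holomorphic_B]) auto
  have f_hol: "f holomorphic_on ball 0 1"
    unfolding f_def using denom_nonzero[OF w]
    by (intro holomorphic_intros holomorphic_on_ballI[OF holomorphic_B]) auto
  have *: "(norm (kern (cis t) w))\<^sup>2 = Re (cis t * (f (cis t) / (cis t - w)))" for t
  proof -
    define e where "e = cis t"
    have e: "norm e = 1" "e \<noteq> 0" "cnj e = inverse e" by (auto simp: e_def cis_cnj)
    have d: "1 - cnj w * e \<noteq> 0" using denom_nonzero[OF w, of e] e by simp
    then have d': "1 - cnj e * w \<noteq> 0"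
      by (metis complex_cnj_cnj complex_cnj_diff complex_cnj_mult complex_cnj_one complex_cnj_zero mult.commute)
    have k: "kern e w = (1 - cnj (B e) * B w) / (1 - cnj e * w)"
      using kern_eq[of e w] w e(1) d' by (simp add: nonzero_eq_divide_eq mult.commute)
    have n1: "(norm (1 - cnj (B e) * B w))\<^sup>2 = Re (1 + B w * cnj (B w) - 2 * cnj (B w) * B e)"
    proof -
      have "B e * cnj (B e) = 1" using complex_norm_square[of "B e"] norm_B_circle[OF e(1)] by simp
      then have "(1 - cnj (B e) * B w) * cnj (1 - cnj (B e) * B w) =
          1 + B w * cnj (B w) - cnj (B w) * B e - cnj (cnj (B w) * B e)"
        by (simp add: algebra_simps)
      then have "of_real ((norm (1 - cnj (B e) * B w))\<^sup>2) =
          1 + B w * cnj (B w) - cnj (B w) * B e - cnj (cnj (B w) * B e)"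
        by (simp only: complex_norm_square)
      then have "(norm (1 - cnj (B e) * B w))\<^sup>2 =
          Re (1 + B w * cnj (B w) - cnj (B w) * B e - cnj (cnj (B w) * B e))"
        by (metis Re_complex_of_real)
      then show ?thesis by simp
    qed
    have n2: "of_real ((norm (1 - cnj e * w))\<^sup>2) = (e - w) * (1 - cnj w * e) / e"
    proof -
      have "of_real ((norm (1 - cnj e * w))\<^sup>2) = (1 - cnj e * w) * (1 - cnj w * e)"
        by (simp only: complex_norm_square) simp
      moreover have "1 - cnj e * w = (e - w) / e" using e by (simp add: field_simps)
      ultimately show ?thesis by (metis times_divide_eq_left)
    qed
    have "e * (f e / (e - w)) = (1 + B w * cnj (B w) - 2 * cnj (B w) * B e) / of_real ((norm (1 - cnj e * w))\<^sup>2)"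
      unfolding f_def n2 by (simp add: mult.commute)
    then have "Re (e * (f e / (e - w))) = (norm (1 - cnj (B e) * B w))\<^sup>2 / (norm (1 - cnj e * w))\<^sup>2"
      by (simp only: Re_divide_of_real n1)
    then show ?thesis
      unfolding e_def[symmetric] k by (simp add: norm_divide power_divide)
  qed
  have c: "continuous_on {0..2*pi} (\<lambda>t. cis t * (f (cis t) / (cis t - w)))"
    using w by (intro continuous_intros continuous_on_compose_cis[OF f_cont]) auto
  have "integral {0..2*pi} (\<lambda>t. (norm (kern (cis t) w))\<^sup>2) = Re (2 * pi * f w)"
    unfolding * integral_cis_Cauchy[OF f_cont f_hol w, symmetric]
    using integral_linear[OF integrable_continuous_real[OF c] bounded_linear_Re] by (simp add: o_def)
  \<comment> \<open>At \<open>w\<close> the numerator of \<open>f\<close> becomes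
    \<open>1 - |B w|^2\<close>.\<close>
  also have "f w = kern w w"
  proof -
    have "1 - cnj w * w \<noteq> 0" using denom_nonzero[OF w, of w] w by simp
    then show ?thesis using kern_eq[of w w] w by (simp add: f_def field_simps)
  qed
  finally show ?thesis by simp
qed

lemma continuous_on_kern_diag: "continuous_on (cball 0 1) (\<lambda>w. kern w w)"
  by (rule continuous_on_compose2[OF continuous_on_kern, of _ "\<lambda>w. (w, w)", unfolded split_beta fst_conv snd_conv])
    (auto intro!: continuous_intros)

lemma continuous_on_kern_cis:
  "continuous_on (cball 0 1 \<times> S) (\<lambda>q. kern (cis (snd q)) (fst q))"
  by (rule continuous_on_compose2[OF continuous_on_kern, of _ "\<lambda>q. (cis (snd q), fst q)", unfolded split_beta fst_conv snd_conv])
    (auto intro!: continuous_intros)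

text \<open>Continuity adds the case \<open>|w| = 1\<close>, the edge \<open>r = 1\<close> of
  \<open>polar_box\<close>.\<close>

lemma integral_norm_kern:
  assumes w: "norm w \<le> 1"
  shows "integral {0..2*pi} (\<lambda>t. (norm (kern (cis t) w))\<^sup>2) = 2 * pi * Re (kern w w)"
proof (rule eq_on_cball[OF _ _ integral_norm_kern_aux w])
  show "continuous_on (cball 0 1) (\<lambda>w. integral {0..2*pi} (\<lambda>t. (norm (kern (cis t) w))\<^sup>2))"
    unfolding interval_cbox
    by (rule integral_continuous_on_param)
      (unfold split_beta, intro continuous_intros continuous_on_kern_cis)
qed (intro continuous_intros continuous_on_kern_diag)


text \<open>Obtained by differentiating \<open>B Q = z\<^sup>n cnj Q\<close> along the circle.\<close>

lemma deriv_B_circle: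
  "cnj (B (cis t)) * cis t * deriv B (cis t) =
     of_nat n - cnj (cis t * (poly (pderiv Q) (cis t) / poly Q (cis t))) -
       cis t * (poly (pderiv Q) (cis t) / poly Q (cis t))"
proof -
  define e where "e = cis t"
  have e: "norm e = 1" by (simp add: e_def)
  have q: "poly Q e \<noteq> 0" "cnj (poly Q e) \<noteq> 0" using nonzero e by auto
  have BB: "cnj (B e) * B e = 1"
    using complex_norm_square[of "B e"] norm_B_circle[OF e] by (simp add: mult.commute)
  have eU: "of_real 1 * cis t \<in> U" using mem_U e by (simp add: e_def)
  have Q': "deriv (poly Q) e = poly (pderiv Q) e"
    by (rule DERIV_imp_deriv) (rule poly_DERIV)
  have pow: "e * deriv (\<lambda>z. z ^ n) e = of_nat n * e ^ n"
  proof -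
    \<comment> \<open>For \<open>n = 0\<close> the exponent \<open>n - 1\<close> truncates to 0, but
      the factor \<open>of_nat n\<close> vanishes.\<close>
    have "deriv (\<lambda>z. z ^ n) e = of_nat n * e ^ (n - 1)"
      by (rule DERIV_imp_deriv) (auto intro!: derivative_eq_intros)
    then show ?thesis by (cases n) (simp_all add: mult_ac)
  qed
  note d = has_vector_derivative_angle[of _ _ 1 t, unfolded of_real_1 mult_1_left, folded e_def]
  have 1: "((\<lambda>t. B (cis t) * poly Q (cis t)) has_vector_derivative
      B e * (\<i> * e * poly (pderiv Q) e) + \<i> * e * deriv B e * poly Q e) (at t)"
    using has_vector_derivative_mult[OF d[OF open_U holomorphic_B] d[OF open_UNIV, of "poly Q"]] eU
    by (simp add: e_def Q'[unfolded e_def] holomorphic_intros mult_ac)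
  have 2: "((\<lambda>t. cis t ^ n * cnj (poly Q (cis t))) has_vector_derivative
      e ^ n * cnj (\<i> * e * poly (pderiv Q) e) + \<i> * (e * deriv (\<lambda>z. z ^ n) e) * cnj (poly Q e)) (at t)"
    using has_vector_derivative_mult[OF d[OF open_UNIV, of "\<lambda>z. z ^ n"]
        bounded_linear.has_vector_derivative[OF bounded_linear_cnj d[OF open_UNIV, of "poly Q"]]]
    by (simp add: e_def Q'[unfolded e_def] holomorphic_intros mult_ac)
  have eq: "B (cis t) * poly Q (cis t) = cis t ^ n * cnj (poly Q (cis t))" for t
    using nonzero[of "cis t"] by (simp add: B_def conj_rev_circle[OF degree_le])
  have "B e * (\<i> * e * poly (pderiv Q) e) + \<i> * e * deriv B e * poly Q e =
      e ^ n * cnj (\<i> * e * poly (pderiv Q) e) + \<i> * (of_nat n * e ^ n) * cnj (poly Q e)"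
    using vector_derivative_unique_at[OF 1[unfolded eq] 2] by (simp only: pow)
  also have "e ^ n = B e * poly Q e / cnj (poly Q e)"
    using eq[of t] q by (simp add: e_def)
  finally have "\<i> * (e * deriv B e * poly Q e) =
      \<i> * (B e * (of_nat n * poly Q e - poly Q e / cnj (poly Q e) * cnj (e * poly (pderiv Q) e) - e * poly (pderiv Q) e))"
    using q by (simp add: algebra_simps)
  then have "e * deriv B e * poly Q e =
      B e * (of_nat n * poly Q e - poly Q e / cnj (poly Q e) * cnj (e * poly (pderiv Q) e) - e * poly (pderiv Q) e)"
    by simp
  then have "e * deriv B e =
      B e * (of_nat n - cnj (e * (poly (pderiv Q) e / poly Q e)) - e * (poly (pderiv Q) e / poly Q e))"
    using q by (simp add: field_simps)
  then have "cnj (B e) * e * deriv B e = (cnj (B e) * B e) *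
       (of_nat n - cnj (e * (poly (pderiv Q) e / poly Q e)) - e * (poly (pderiv Q) e / poly Q e))"
    by (simp only: mult.assoc)
  then show ?thesis by (simp only: BB mult_1_left flip: e_def)
qed

lemma continuous_on_deriv_B: "continuous_on (cball 0 1) (deriv B)"
  by (intro continuous_on_cballI holomorphic_deriv holomorphic_B open_U)

text \<open>Green's formula with \<open>G = B\<close> and \<open>h = deriv B\<close> moves the
  integral to the circle. There \<open>deriv_B_circle\<close> leaves the constant \<open>n\<close>
  and two terms of mean zero, because \<open>Q\<close> has no zeros in the closed disc.\<close>

lemma integral_norm_deriv_B:
  "integral polar_box (\<lambda>p. fst p * (norm (deriv B (polar p)))\<^sup>2) = pi * n"
proof -
  define f where "f = (\<lambda>z. poly (pderiv Q) z / poly Q z)"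
  have f: "f holomorphic_on U"
    unfolding f_def by (intro holomorphic_intros) (auto simp: U_def)
  have c: "continuous_on {0..2*pi} (\<lambda>t. cis t * f (cis t))"
    by (intro continuous_intros continuous_on_compose_cis continuous_on_cballI f)
  have i0: "((\<lambda>t. cis t * f (cis t)) has_integral 0) {0..2*pi}"
    using integral_cis_holomorphic[OF continuous_on_cballI[OF f] holomorphic_on_ballI[OF f]]
      integrable_continuous_real[OF c] by (simp add: has_integral_iff)
  then have i1: "((\<lambda>t. cnj (cis t * f (cis t))) has_integral 0) {0..2*pi}"
    using has_integral_cnj[of "\<lambda>t. cis t * f (cis t)" 0 "{0..2*pi}"] by (simp add: o_def)
  have "((\<lambda>t. of_nat n - cnj (cis t * f (cis t)) - cis t * f (cis t)) has_integral (2 * pi) *\<^sub>R of_nat n - 0 - 0) {0..2*pi}"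
    using has_integral_const_real[of "of_nat n :: complex" 0 "2*pi"]
    by (intro has_integral_diff i0 i1) simp
  then have "integral {0..2*pi} (\<lambda>t. cnj (B (cis t)) * cis t * deriv B (cis t)) = 2 * pi * n"
    unfolding deriv_B_circle f_def by (simp add: integral_unique scaleR_conv_of_real)
  then have "2 * integral polar_box (\<lambda>p. of_real (fst p) * cnj (deriv B (polar p)) * deriv B (polar p)) = 2 * pi * n"
    by (subst green_disc[OF open_U cball_subset_U holomorphic_B holomorphic_deriv[OF holomorphic_B open_U]])
  moreover have "of_real (fst p) * cnj (deriv B (polar p)) * deriv B (polar p) =
      complex_of_real (fst p * (norm (deriv B (polar p)))\<^sup>2)" for p
    by (simp only: of_real_mult complex_norm_square mult_ac)
  ultimately have "integral polar_box (\<lambda>p. complex_of_real (fst p * (norm (deriv B (polar p)))\<^sup>2)) = of_real (pi * n)"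
    by simp
  moreover have "(\<lambda>p. fst p * (norm (deriv B (polar p)))\<^sup>2) integrable_on polar_box"
    by (intro integrable_continuous continuous_intros continuous_on_compose_polar continuous_on_deriv_B)
  then have "integral polar_box (\<lambda>p. complex_of_real (fst p * (norm (deriv B (polar p)))\<^sup>2)) =
      of_real (integral polar_box (\<lambda>p. fst p * (norm (deriv B (polar p)))\<^sup>2))"
    using integral_linear[OF _ bounded_linear_of_real]
    unfolding o_def by blast
  ultimately show ?thesis by (metis of_real_eq_iff)
qed

section \<open>Hardy's inequality for the diagonal of the kernel\<close>

text \<open>This is the weight \<open>u\<close>; unlike the quotient, \<open>kern w w\<close> is
  continuous up to the circle.\<close>

lemma Re_kern_diag:
  assumes "norm w < 1"
  shows "Re (kern w w) = (1 - (norm (B w))\<^sup>2) / (1 - (norm w)\<^sup>2)"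
proof -
  have w: "(norm w)\<^sup>2 < 1" using assms by (simp add: power_less_one_iff abs_square_less_1)
  have "(1 - of_real ((norm w)\<^sup>2)) * kern w w = 1 - of_real ((norm (B w))\<^sup>2)"
    using kern_eq[of w w] assms by (simp only: complex_norm_square mult.commute)
  then have "of_real (1 - (norm w)\<^sup>2) * kern w w = of_real (1 - (norm (B w))\<^sup>2)"
    by simp
  then have "Re (of_real (1 - (norm w)\<^sup>2) * kern w w) = 1 - (norm (B w))\<^sup>2"
    by (metis Re_complex_of_real)
  then have "(1 - (norm w)\<^sup>2) * Re (kern w w) = 1 - (norm (B w))\<^sup>2"
    by (simp only: times_complex.sel Re_complex_of_real Im_complex_of_real mult_zero_left diff_zero)
  then show ?thesis using w by (simp add: field_simps)
qed

text \<open>Hardy's inequality for \<open>g = 1 - |B|\<^sup>2\<close>, which vanishes at \<open>r = 1\<close>: with \<open>v = g / (1 - r\<^sup>2)\<close> the function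
  \<open>2 r v\<^sup>2 + 2 r\<^sup>2 v g'\<close> is the derivative of \<open>r\<^sup>2 (1 - r\<^sup>2) v\<^sup>2\<close>, so its integral is zero.\<close>

lemma hardy_radial:
  "integral {0..1} (\<lambda>r. r * (Re (kern (polar (r, t)) (polar (r, t))))\<^sup>2) \<le>
     4 * integral {0..1} (\<lambda>r. r * (norm (deriv B (polar (r, t))))\<^sup>2)"
proof -
  define w where "w = (\<lambda>r. polar (r, t))"
  have w: "w r = of_real r * cis t" for r by (simp add: w_def polar_def)
  define v where "v = (\<lambda>r. Re (kern (w r) (w r)))"
  define g where "g = (\<lambda>r. 1 - (norm (B (w r)))\<^sup>2)"
  define g' where "g' = (\<lambda>r. - 2 * Re (cnj (B (w r)) * (cis t * deriv B (w r))))"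
  have wc: "continuous_on {0..1} w" "w ` {0..1} \<subseteq> cball 0 1"
    by (auto simp: w norm_mult intro!: continuous_intros)
  have comp: "continuous_on {0..1} (\<lambda>r. f (w r))" if "continuous_on (cball 0 1) f" for f :: "complex \<Rightarrow> complex"
    using continuous_on_compose2[OF that wc] .
  have cv: "continuous_on {0..1} v"
    unfolding v_def by (intro continuous_intros comp continuous_on_kern_diag)
  have cg': "continuous_on {0..1} g'"
    unfolding g'_def
    by (intro continuous_intros comp continuous_on_cballI[OF holomorphic_B] continuous_on_deriv_B)
  have cB': "continuous_on {0..1} (\<lambda>r. norm (deriv B (w r)))"
    by (intro continuous_intros comp continuous_on_deriv_B)
  have g_deriv: "(g has_real_derivative g' r) (at r)" if "r \<in> {0..1}" for r
  proof -
    have "w r \<in> U" using that by (intro mem_U) (auto simp: w norm_mult)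
    then have 1: "((\<lambda>r. B (w r)) has_vector_derivative cis t * deriv B (w r)) (at r)"
      unfolding w by (rule has_vector_derivative_radius[OF open_U holomorphic_B])
    have "((\<lambda>r. Re (cnj (B (w r)) * B (w r))) has_vector_derivative
        Re (cnj (B (w r)) * (cis t * deriv B (w r)) + cnj (cis t * deriv B (w r)) * B (w r))) (at r)"
      by (intro bounded_linear.has_vector_derivative[OF bounded_linear_Re] has_vector_derivative_mult
          bounded_linear.has_vector_derivative[OF bounded_linear_cnj] 1)
    then have "((\<lambda>r. 1 - Re (cnj (B (w r)) * B (w r))) has_real_derivative
        0 - Re (cnj (B (w r)) * (cis t * deriv B (w r)) + cnj (cis t * deriv B (w r)) * B (w r))) (at r)"
      by (intro DERIV_diff) (auto simp: has_real_derivative_iff_has_vector_derivative)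
    moreover have "1 - Re (cnj (B (w r)) * B (w r)) = g r" for r
      unfolding g_def cmod_power2 by (simp add: power2_eq_square)
    moreover have "0 - Re (cnj (B (w r)) * (cis t * deriv B (w r)) + cnj (cis t * deriv B (w r)) * B (w r)) = g' r"
      by (simp add: g'_def algebra_simps)
    ultimately show ?thesis by simp
  qed
  have v_eq: "v r = g r / (1 - r\<^sup>2)" if "r \<in> {0<..<1}" for r
    using Re_kern_diag[of "w r"] that by (simp add: v_def g_def w norm_mult)
  \<comment> \<open>The antiderivative vanishes at both ends. The quotient form of \<open>v\<close>
    holds only inside; at the ends continuity of \<open>v\<close> suffices.\<close>
  have "((\<lambda>r. 2 * r * (v r)\<^sup>2 + 2 * r\<^sup>2 * v r * g' r) has_integral
      1\<^sup>2 * (1 - 1\<^sup>2) * (v 1)\<^sup>2 - 0\<^sup>2 * (1 - 0\<^sup>2) * (v 0)\<^sup>2) {0..1}"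
  proof (rule fundamental_theorem_of_calculus_interior)
    show "continuous_on {0..1} (\<lambda>r. r\<^sup>2 * (1 - r\<^sup>2) * (v r)\<^sup>2)"
      by (intro continuous_intros cv)
    fix r :: real assume r: "r \<in> {0<..<1}"
    then have nz: "1 - r\<^sup>2 \<noteq> 0" by (auto simp: power2_eq_1_iff)
    \<comment> \<open>The derivative of \<open>g\<close> is known, so the antiderivative is first
      written through \<open>g\<close>; the two forms agree on the open interval.\<close>
    have "((\<lambda>r. r\<^sup>2 / (1 - r\<^sup>2) * (g r)\<^sup>2) has_real_derivative
        2 * r / (1 - r\<^sup>2)\<^sup>2 * (g r)\<^sup>2 + r\<^sup>2 / (1 - r\<^sup>2) * (2 * g r * g' r)) (at r)"
    proof -
      have "((\<lambda>r. r\<^sup>2 / (1 - r\<^sup>2)) has_real_derivative 2 * r / (1 - r\<^sup>2)\<^sup>2) (at r)"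
        using nz by (auto intro!: derivative_eq_intros simp: divide_simps power2_eq_square) algebra
      moreover have "((\<lambda>r. (g r)\<^sup>2) has_real_derivative 2 * g r * g' r) (at r)"
        using r by (auto intro!: derivative_eq_intros g_deriv)
      ultimately show ?thesis by (rule DERIV_cong[OF DERIV_mult]) simp
    qed
    also have "2 * r / (1 - r\<^sup>2)\<^sup>2 * (g r)\<^sup>2 + r\<^sup>2 / (1 - r\<^sup>2) * (2 * g r * g' r) =
        2 * r * (v r)\<^sup>2 + 2 * r\<^sup>2 * v r * g' r"
      by (simp add: v_eq[OF r] power_divide)
    finally have "((\<lambda>r. r\<^sup>2 * (1 - r\<^sup>2) * (v r)\<^sup>2) has_real_derivative
        2 * r * (v r)\<^sup>2 + 2 * r\<^sup>2 * v r * g' r) (at r)"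
    proof (rule has_field_derivative_transform_within_open[where S = "{0<..<1}"])
      fix s :: real assume s: "s \<in> {0<..<1}"
      then have "1 - s\<^sup>2 \<noteq> 0" by (auto simp: power2_eq_1_iff)
      then show "s\<^sup>2 / (1 - s\<^sup>2) * (g s)\<^sup>2 = s\<^sup>2 * (1 - s\<^sup>2) * (v s)\<^sup>2"
        by (simp add: v_eq[OF s] power_divide) (simp add: power2_eq_square)
    qed (use r in auto)
    then show "((\<lambda>r. r\<^sup>2 * (1 - r\<^sup>2) * (v r)\<^sup>2) has_vector_derivative
        2 * r * (v r)\<^sup>2 + 2 * r\<^sup>2 * v r * g' r) (at r)"
      by (simp add: has_real_derivative_iff_has_vector_derivative)
  qed simp
  then have FT: "((\<lambda>r. 2 * r * (v r)\<^sup>2 + 2 * r\<^sup>2 * v r * g' r) has_integral 0) {0..1}" by simp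
  have i4: "(\<lambda>r. 4 * (r * (norm (deriv B (w r)))\<^sup>2)) integrable_on {0..1}"
    by (intro integrable_continuous_real continuous_intros cB')
  \<comment> \<open>The bracket added on the right has integral zero.\<close>
  have "integral {0..1} (\<lambda>r. r * (v r)\<^sup>2) \<le>
      integral {0..1} (\<lambda>r. (2 * r * (v r)\<^sup>2 + 2 * r\<^sup>2 * v r * g' r) + 4 * (r * (norm (deriv B (w r)))\<^sup>2))"
  proof (rule integral_le)
    fix r :: real assume r: "r \<in> {0..1}"
    have nB: "norm (B (w r)) \<le> 1" using r by (intro norm_B_le) (auto simp: w norm_mult)
    have "\<bar>g' r\<bar> \<le> 2 * norm (cnj (B (w r)) * (cis t * deriv B (w r)))"
      using abs_Re_le_cmod[of "cnj (B (w r)) * (cis t * deriv B (w r))"] by (simp only: g'_def)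
    also have "\<dots> \<le> 2 * norm (deriv B (w r))"
      using nB by (simp add: norm_mult mult_left_le_one_le)
    finally have "\<bar>g' r\<bar>\<^sup>2 \<le> (2 * norm (deriv B (w r)))\<^sup>2" by (intro power_mono) auto
    then have "r * (g' r)\<^sup>2 \<le> r * (4 * (norm (deriv B (w r)))\<^sup>2)"
      using r by (intro mult_left_mono) (auto simp: power_mult_distrib)
    \<comment> \<open>Completed square: \<open>v^2 + 2 * r * v * g' + g'^2\<close> equals
      \<open>(v + r * g')^2 + (1 - r^2) * g'^2\<close>.\<close>
    moreover have "0 \<le> r * ((v r + r * g' r)\<^sup>2 + (1 - r\<^sup>2) * (g' r)\<^sup>2)"
      using r by (intro mult_nonneg_nonneg add_nonneg_nonneg) (auto simp: power_le_one)
    ultimately show "r * (v r)\<^sup>2 \<le> (2 * r * (v r)\<^sup>2 + 2 * r\<^sup>2 * v r * g' r) + 4 * (r * (norm (deriv B (w r)))\<^sup>2)"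
      by (simp add: algebra_simps power2_eq_square)
  next
    show "(\<lambda>r. r * (v r)\<^sup>2) integrable_on {0..1}"
      by (intro integrable_continuous_real continuous_intros cv)
  qed (intro integrable_add i4 has_integral_integrable[OF FT])
  also have "\<dots> = 4 * integral {0..1} (\<lambda>r. r * (norm (deriv B (w r)))\<^sup>2)"
    using FT i4 by (subst integral_add) (auto simp: has_integral_iff)
  finally show ?thesis unfolding v_def w_def .
qed

text \<open>Hardy's inequality on each radius, integrated over the angle: it gives the factor 4, and
  the Dirichlet integral of \<open>B\<close> gives \<open>pi * n\<close>.\<close>

lemma integral_kern_diag_le:
  "integral polar_box (\<lambda>p. fst p * (Re (kern (polar p) (polar p)))\<^sup>2) \<le> 4 * pi * n"
proof -
  have swap: "integral polar_box f = integral {0..2*pi} (\<lambda>t. integral {0..1} (\<lambda>r. f (r, t)))"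
    and int: "(\<lambda>t. integral {0..1} (\<lambda>r. f (r, t))) integrable_on {0..2*pi}"
    if f: "continuous_on polar_box f" for f :: "real \<times> real \<Rightarrow> real"
  proof -
    have f': "continuous_on polar_box (\<lambda>(r, t). f (r, t))" using f by simp
    show "integral polar_box f = integral {0..2*pi} (\<lambda>t. integral {0..1} (\<lambda>r. f (r, t)))"
      using integral_prod_continuous[OF f] integral_swap_continuous[OF f'] by simp
    have "continuous_on ({0..2*pi} \<times> cbox 0 1) (\<lambda>(t, r). f (r, t))"
      unfolding split_beta
      by (rule continuous_on_compose2[OF f]) (auto intro!: continuous_intros)
    then show "(\<lambda>t. integral {0..1} (\<lambda>r. f (r, t))) integrable_on {0..2*pi}"
      using integral_continuous_on_param[of "{0..2*pi}" 0 1 "\<lambda>t r. f (r, t)"]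
      by (intro integrable_continuous_real) simp
  qed
  have c1: "continuous_on polar_box (\<lambda>p. fst p * (Re (kern (polar p) (polar p)))\<^sup>2)"
    by (intro continuous_intros continuous_on_compose_polar continuous_on_kern_diag)
  have c2: "continuous_on polar_box (\<lambda>p. fst p * (norm (deriv B (polar p)))\<^sup>2)"
    by (intro continuous_intros continuous_on_compose_polar continuous_on_deriv_B)
  have "integral polar_box (\<lambda>p. fst p * (Re (kern (polar p) (polar p)))\<^sup>2) \<le>
      integral {0..2*pi} (\<lambda>t. 4 * integral {0..1} (\<lambda>r. r * (norm (deriv B (polar (r, t))))\<^sup>2))"
    unfolding swap[OF c1] using int[OF c1] int[OF c2] hardy_radial
    by (intro integral_le integrable_on_cmult_left) auto
  also have "\<dots> = 4 * (pi * n)"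
    using swap[OF c2] integral_norm_deriv_B by simp
  finally show ?thesis by simp
qed

section \<open>The estimate for the integral of \<open>|R'|\<close>\<close>

lemma integral_norm_deriv_le:
  assumes P: "degree P \<le> n" and R: "\<And>w. R w = poly P w / poly Q w" and n: "n > 0"
    and inj: "inj_on R (ball 0 1)" and bound: "\<And>z. norm z < 1 \<Longrightarrow> norm (R z) \<le> 1"
  shows "integral {0..2*pi} (\<lambda>t. norm (deriv R (cis t))) \<le> 4 * pi * sqrt n"
proof -
  have R': "R = (\<lambda>w. poly P w / poly Q w)" using R by auto
  have holR: "R holomorphic_on U"
    unfolding R' by (intro holomorphic_intros) (auto simp: U_def)
  have cR: "continuous_on (cball 0 1) (deriv R)"
    by (intro continuous_on_cballI holomorphic_deriv open_U holR)
  define a where "a = (\<lambda>p. norm (deriv R (polar p)))"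
  define u where "u = (\<lambda>p. Re (kern (polar p) (polar p)))"
  have ca: "continuous_on polar_box a"
    unfolding a_def by (intro continuous_intros continuous_on_compose_polar cR)
  have cu: "continuous_on polar_box u"
    unfolding u_def by (intro continuous_intros continuous_on_compose_polar continuous_on_kern_diag)
  \<comment> \<open>On \<open>polar_box\<close>, \<open>K t\<close> is the modulus of the
    reproducing integrand at \<open>cis t\<close>.\<close>
  define K where "K = (\<lambda>t p. fst p * a p * (norm (kern (cis t) (polar p)))\<^sup>2)"
  have cK: "continuous_on (cbox (0, (0, 0)) (2*pi, (1, 2*pi))) (\<lambda>(t, p). K t p)"
  proof -
    have 1: "continuous_on ({0..2*pi} \<times> polar_box) (\<lambda>q. kern (cis (fst q)) (polar (snd q)))"
      by (rule continuous_on_compose2[OF continuous_on_kern_cis[of UNIV], of _ "\<lambda>q. (polar (snd q), fst q)", unfolded fst_conv snd_conv])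
        (use polar_in_cball in \<open>force intro!: continuous_intros continuous_on_compose2[OF continuous_on_polar[of UNIV]]\<close>)+
    have 2: "continuous_on ({0..2*pi} \<times> polar_box) (\<lambda>q. a (snd q))"
      by (rule continuous_on_compose2[OF ca continuous_on_snd[OF continuous_on_id]]) auto
    show ?thesis
      unfolding K_def split_beta cbox_Pair_eq[of _ "(0, 0)"] box_real
      by (intro continuous_intros 1 2)
  qed
  have pointwise: "norm (deriv R (cis t)) \<le> integral polar_box (K t) / pi" for t
  proof -
    have "pi * norm (deriv R (cis t)) = norm (pi * cnj (deriv R (cis t)))"
      by (simp add: norm_mult)
    also have "pi * cnj (deriv R (cis t)) = integral polar_box
        (\<lambda>p. of_real (fst p) * cnj (deriv R (polar p)) * (kern (cis t) (polar p))\<^sup>2)"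
      by (rule reproducing[OF P R, symmetric]) simp
    also have "norm \<dots> \<le> integral polar_box (K t)"
    proof (rule integral_norm_bound_integral)
      have k: "continuous_on polar_box (\<lambda>p. kern (cis t) (polar p))"
        by (intro continuous_on_compose_polar continuous_on_cballI holomorphic_kern)
      show "(\<lambda>p. complex_of_real (fst p) * cnj (deriv R (polar p)) * (kern (cis t) (polar p))\<^sup>2) integrable_on polar_box"
        by (intro integrable_continuous continuous_intros continuous_on_compose_polar cR k)
      show "K t integrable_on polar_box"
        unfolding K_def by (intro integrable_continuous continuous_intros ca k)
      show "norm (complex_of_real (fst p) * cnj (deriv R (polar p)) * (kern (cis t) (polar p))\<^sup>2) \<le> K t p"
        if "p \<in> polar_box" for p
        using that by (cases p) (simp add: K_def a_def norm_mult norm_power)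
    qed
    finally show ?thesis by (simp add: field_simps)
  qed
  have "integral {0..2*pi} (\<lambda>t. norm (deriv R (cis t))) \<le> integral {0..2*pi} (\<lambda>t. integral polar_box (K t) / pi)"
  proof (rule integral_le)
    show "(\<lambda>t. norm (deriv R (cis t))) integrable_on {0..2*pi}"
      by (intro integrable_continuous_real continuous_intros continuous_on_compose_cis cR)
    have "continuous_on {0..2*pi} (\<lambda>t. integral polar_box (K t))"
      by (rule integral_continuous_on_param) (use cK in \<open>simp add: cbox_Pair_eq[of _ "(0, 0)"]\<close>)
    then show "(\<lambda>t. integral polar_box (K t) / pi) integrable_on {0..2*pi}"
      by (intro integrable_continuous_real continuous_intros) auto
  qed (rule pointwise)
  also have "\<dots> = integral {0..2*pi} (\<lambda>t. integral polar_box (K t)) / pi"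
    by simp
  also have "integral {0..2*pi} (\<lambda>t. integral polar_box (K t)) = integral polar_box (\<lambda>p. integral {0..2*pi} (\<lambda>t. K t p))"
    using integral_swap_continuous[OF cK] by simp
  also have "\<dots> = integral polar_box (\<lambda>p. 2 * pi * (fst p * a p * u p))"
  proof (rule integral_cong)
    fix p assume "p \<in> polar_box"
    then have "norm (polar p) \<le> 1" using polar_in_cball by auto
    then show "integral {0..2*pi} (\<lambda>t. K t p) = 2 * pi * (fst p * a p * u p)"
      by (simp add: K_def u_def integral_norm_kern)
  qed
  also have "\<dots> = 2 * pi * integral polar_box (\<lambda>p. fst p * a p * u p)" by simp
  \<comment> \<open>Cauchy-Schwarz in the form \<open>x * y \<le> s * x^2 + y^2 / (4 * s)\<close>;
    the choice \<open>s = sqrt n\<close> balances the bounds \<open>pi\<close> and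
    \<open>4 * pi * n\<close>.\<close>
  also have "integral polar_box (\<lambda>p. fst p * a p * u p) \<le>
      integral polar_box (\<lambda>p. sqrt n * (fst p * (a p)\<^sup>2) + 1 / (4 * sqrt n) * (fst p * (u p)\<^sup>2))"
  proof (rule integral_le)
    fix p assume "p \<in> polar_box"
    then have p: "0 \<le> fst p" by (cases p) auto
    have s: "sqrt n > 0" using n by simp
    have "0 \<le> (2 * sqrt n * a p - u p)\<^sup>2 / (4 * sqrt n)" using s by simp
    also have "\<dots> = sqrt n * (a p)\<^sup>2 + 1 / (4 * sqrt n) * (u p)\<^sup>2 - a p * u p"
      using s by (simp add: power2_eq_square field_simps)
    finally have "fst p * (a p * u p) \<le> fst p * (sqrt n * (a p)\<^sup>2 + 1 / (4 * sqrt n) * (u p)\<^sup>2)"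
      using p by (intro mult_left_mono) auto
    then show "fst p * a p * u p \<le> sqrt n * (fst p * (a p)\<^sup>2) + 1 / (4 * sqrt n) * (fst p * (u p)\<^sup>2)"
      by (simp add: algebra_simps)
  qed (intro integrable_continuous continuous_intros ca cu)+
  also have "\<dots> = sqrt n * integral polar_box (\<lambda>p. fst p * (a p)\<^sup>2) +
      1 / (4 * sqrt n) * integral polar_box (\<lambda>p. fst p * (u p)\<^sup>2)"
    by (subst integral_add) (intro integrable_continuous continuous_intros ca cu | simp)+
  also have "\<dots> \<le> sqrt n * pi + 1 / (4 * sqrt n) * (4 * pi * n)"
    using univalent_area_le[OF open_U cball_subset_U holR inj bound] integral_kern_diag_le
    by (intro add_mono mult_left_mono) (auto simp: a_def u_def)
  also have "\<dots> = 2 * pi * sqrt n"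
    using n by (simp add: field_simps)
  finally show ?thesis by (simp add: field_simps)
qed

end

subsection \<open>The normalized measure on the circle\<close>

text \<open>\<open>circle_measure\<close> is a measure on the whole plane, hence global
  measurability, but it is carried by the circle, where continuity is asked.\<close>

lemma integral_circle_measure:
  fixes f :: "complex \<Rightarrow> real"
  assumes [measurable]: "f \<in> borel_measurable borel" and cont: "continuous_on (sphere 0 1) f"
  shows "(\<integral>z. f z \<partial>circle_measure) = integral {0..2*pi} (\<lambda>t. f (cis t)) / (2 * pi)"
proof -
  have c: "continuous_on S (\<lambda>t. f (cis t))" for S
    by (rule continuous_on_compose2[OF cont]) (auto intro!: continuous_intros)
  have [measurable]: "cis \<in> borel_measurable borel"
    by (intro borel_measurable_continuous_onI continuous_intros)
  have um: "uniform_measure lborel {0..<2 * pi} = density lborel (\<lambda>t. ennreal (indicator {0..<2*pi} t / (2 * pi)))"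
    unfolding uniform_measure_def
    by (rule arg_cong[where f = "density lborel"])
      (auto simp: fun_eq_iff divide_ennreal[symmetric] ennreal_indicator)
  have int: "set_integrable lborel {0..2*pi} (\<lambda>t. f (cis t))"
    unfolding set_integrable_def by (intro borel_integrable_compact c) auto
  have "(\<integral>z. f z \<partial>circle_measure) = (\<integral>t. f (cis t) \<partial>uniform_measure lborel {0..<2*pi})"
    unfolding circle_measure_def by (subst integral_distr) auto
  also have "\<dots> = (\<integral>t. (indicator {0..<2*pi} t / (2 * pi)) *\<^sub>R f (cis t) \<partial>lborel)"
    unfolding um by (subst integral_density) auto
  also have "\<dots> = (\<integral>t. (indicator {0..<2*pi} t *\<^sub>R f (cis t)) / (2 * pi) \<partial>lborel)"
    by (intro Bochner_Integration.integral_cong) auto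
  also have "\<dots> = (LINT t:{0..<2*pi}|lborel. f (cis t)) / (2 * pi)"
    by (simp add: set_lebesgue_integral_def)
  also have "(LINT t:{0..<2*pi}|lborel. f (cis t)) = integral {0..<2*pi} (\<lambda>t. f (cis t))"
    by (intro set_borel_integral_eq_integral set_integrable_subset[OF int]) auto
  \<comment> \<open>The two intervals differ by the point \<open>2 * pi\<close>.\<close>
  also have "\<dots> = integral {0..2*pi} (\<lambda>t. f (cis t))"
    by (rule integral_subset_negligible)
      (auto intro: negligible_subset[OF negligible_sing[of "2*pi"]])
  finally show ?thesis .
qed

text \<open>Lowest terms exclude a common zero, so every zero of \<open>Q\<close> is a genuine pole.
  This turns absence of poles of \<open>R\<close> into absence of zeros of \<open>Q\<close>.\<close>

lemma is_pole_quotient: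
  fixes P Q :: "complex poly"
  assumes "Q \<noteq> 0" "coprime P Q" "poly Q z = 0"
  shows "is_pole (\<lambda>w. poly P w / poly Q w) z"
proof (rule is_pole_divide)
  show "poly P z \<noteq> 0"
  proof
    assume "poly P z = 0"
    then have "[:-z, 1:] dvd 1"
      using assms by (meson coprime_common_divisor poly_eq_0_iff_dvd)
    then have "poly 1 z = 0" by (simp only: poly_eq_0_iff_dvd)
    then show False by simp
  qed
  \<comment> \<open>The complement of the other roots is an open neighbourhood of
    \<open>z\<close>.\<close>
  have "open (- {w. poly Q w = 0} \<union> {z})" if "finite {w. poly Q w = 0}"
  proof -
    have "- {w. poly Q w = 0} \<union> {z} = - ({w. poly Q w = 0} - {z})" by auto
    then show ?thesis using that by (simp only: open_Compl finite_imp_closed finite_Diff)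
  qed
  then have "\<forall>\<^sub>F w in at z. poly Q w \<noteq> 0"
    unfolding eventually_at_topological
    using poly_roots_finite[OF assms(1)] by (intro exI[of _ "- {w. poly Q w = 0} \<union> {z}"]) auto
  then show "filterlim (poly Q) (at 0) (at z)"
    using assms(3) isContD[OF poly_isCont[of z Q]] by (simp add: filterlim_at)
qed (rule poly_isCont)

theorem proposition1p3:
  fixes n :: nat and R :: "complex \<Rightarrow> complex"
  assumes "n > 0"
    and "R \<in> univalent_rational_functions n"
    and "circle_sup_norm R \<le> 1"
  shows "(\<integral>z. norm (deriv R z) \<partial>circle_measure) \<le> 6 * pi * sqrt (real n)"
proof -
  obtain P Q where Q0: "Q \<noteq> 0" and cop: "coprime P Q" and deg: "degree P \<le> n" "degree Q \<le> n"
    and R: "R = (\<lambda>z. poly P z / poly Q z)" and no_pole: "\<And>z. norm z \<le> 1 \<Longrightarrow> \<not> is_pole R z"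
    and inj: "inj_on R (ball 0 1)"
    using assms(2) by (auto simp: univalent_rational_functions_def rational_functions_def)
  interpret zero_free_disc Q n
    by unfold_locales (use deg no_pole is_pole_quotient[OF Q0 cop] in \<open>auto simp: R\<close>)
  have hol: "R holomorphic_on U"
    unfolding R by (intro holomorphic_intros) (auto simp: U_def)
  \<comment> \<open>The real supremum bounds the values only once the set is known to be bounded
    above.\<close>
  have "bdd_above ((\<lambda>z. norm (R z)) ` sphere 0 1)"
    by (intro bounded_imp_bdd_above compact_imp_bounded compact_continuous_image continuous_intros
        continuous_on_subset[OF continuous_on_cballI[OF hol]]) auto
  then have sphere: "norm (R z) \<le> 1" if "norm z = 1" for z
    using cSUP_upper[of z "sphere 0 1" "\<lambda>z. norm (R z)"] assms(3) that
    by (simp add: circle_sup_norm_def)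
  have bound: "norm (R z) \<le> 1" if "norm z < 1" for z
    by (rule maximum_modulus_frontier[of R "cball 0 1"])
      (use holomorphic_on_ballI[OF hol] continuous_on_cballI[OF hol] sphere that in auto)
  have cont: "continuous_on U (\<lambda>z. norm (deriv R z))"
    by (intro continuous_intros holomorphic_on_imp_continuous_on holomorphic_deriv hol open_U)
  \<comment> \<open>Whatever values \<open>deriv R\<close> takes at the finitely many zeros of
    \<open>Q\<close>, it stays measurable.\<close>
  have "(\<lambda>z. norm (deriv R z)) \<in> borel_measurable borel"
  proof (rule borel_measurable_continuous_countable_exceptions)
    show "countable {z. poly Q z = 0}"
      using poly_roots_finite[OF Q0] by (rule countable_finite)
    show "continuous_on (- {z. poly Q z = 0}) (\<lambda>z. norm (deriv R z))"
      by (rule continuous_on_subset[OF cont]) (auto simp: U_def)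
  qed
  then have "(\<integral>z. norm (deriv R z) \<partial>circle_measure) = integral {0..2*pi} (\<lambda>t. norm (deriv R (cis t))) / (2 * pi)"
    by (rule integral_circle_measure)
      (rule continuous_on_subset[OF cont], use cball_subset_U in auto)
  also have "\<dots> \<le> 4 * pi * sqrt n / (2 * pi)"
    using integral_norm_deriv_le[OF deg(1) _ assms(1) inj bound]
    by (intro divide_right_mono) (auto simp: R)
  also have "\<dots> = 2 * sqrt n" by simp
  also have "\<dots> \<le> 6 * pi * sqrt n"
    using pi_gt3 by (intro mult_right_mono) auto
  finally show ?thesis .
qed

end
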